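(* Let $\vec{G}$ be a linearly ordered graph with $n$ vertices, and let $u,v\in V(\vec{G})$ with $l(v)=l(u)+1$ and $u,v$ not adjacent. Then $$\vec{P}_{\vec{G}+uv}(x)=\vec{P}_{\vec{G}-u-v}(x)+\vec{P}_{\vec{G}}(x)+\theta_{uv}(xI-\vec{A}_{\vec{G}})-\theta_{vu}(xI-\vec{A}_{\vec{G}}).$$
   Context: A linearly ordered graph $\vec{G}$ is a finite simple graph whose vertices are labelled $1,\ldots,n$ (the label of $w$ is $l(w)$), with each edge directed from the vertex with the smaller label to the vertex with the larger label. Its skew-adjacency matrix $\vec{A}_{\vec{G}}$ has rows and columns indexed by labels, with $(i,j)$ entry $1$ if $i,j$ are adjacent and $i<j$, $-1$ if $i,j$ are adjacent and $i>j$, and $0$ otherwise; $\vec{P}_{\vec{G}}(x)=\det(xI-\vec{A}_{\vec{G}})$ (equal to $1$ for the empty graph). $\vec{G}+uv$ is the linearly ordered graph obtained from $\vec{G}$ by adding a directed edge from $u$ to $v$. $\vec{G}-u$ is obtained by deleting the vertex $u$ and renumbering the remaining vertices in an order-preserving way; $\vec{G}-u-v$ is obtained by deleting both. For a square matrix $X$, $\theta_{uv}(X)$ is the $(u,v)$ entry (row $l(u)$, column $l(v)$) of the adjugate $\operatorname{adj}(X)$. *)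

theory Defs
  imports
    "Graph_Theory.Pair_Digraph"
    "Jordan_Normal_Form.Char_Poly"
begin

text \<open>
  Arcs run from the smaller to the larger label, which excludes loops and
  antiparallel arcs, so the underlying undirected graph is simple.
\<close>

record 'a lo_graph =
  digraph :: "'a pair_pre_digraph"
  label :: "'a \<Rightarrow> nat"

abbreviation vertices :: "'a lo_graph \<Rightarrow> 'a set" where
  "vertices G \<equiv> pverts (digraph G)"

abbreviation edges :: "'a lo_graph \<Rightarrow> ('a \<times> 'a) set" where
  "edges G \<equiv> parcs (digraph G)"

definition lin_ord_graph :: "'a lo_graph \<Rightarrow> bool" where
  "lin_ord_graph G \<longleftrightarrow>
     pair_digraph (digraph G) \<and>
     bij_betw (label G) (vertices G) {1..card (vertices G)} \<and>
     (\<forall>(x, y) \<in> edges G. label G x < label G y)"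

definition adjacent :: "'a lo_graph \<Rightarrow> 'a \<Rightarrow> 'a \<Rightarrow> bool" where
  "adjacent G x y \<longleftrightarrow> (x, y) \<in> edges G \<or> (y, x) \<in> edges G"

definition add_edge :: "'a lo_graph \<Rightarrow> 'a \<Rightarrow> 'a \<Rightarrow> 'a lo_graph" where
  "add_edge G u v =
     G\<lparr>digraph := \<lparr>pverts = vertices G, parcs = insert (u, v) (edges G)\<rparr>\<rparr>"

text \<open>
  The new label of a vertex is its rank, counted from 1, among the remaining
  vertices with respect to the old labels.
\<close>

definition del_vertex :: "'a lo_graph \<Rightarrow> 'a \<Rightarrow> 'a lo_graph" where
  "del_vertex G u =
     \<lparr>digraph = \<lparr>pverts = vertices G - {u},
                 parcs = {(x, y) \<in> edges G. x \<noteq> u \<and> y \<noteq> u}\<rparr>,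
      label = (\<lambda>w. card {w' \<in> vertices G - {u}. label G w' \<le> label G w})\<rparr>"

text \<open>
  Labels start at 1 but matrix indices start at 0: the row or column belonging
  to label \<open>k\<close> has index \<open>k - 1\<close>.
\<close>

definition skew_adj_mat :: "'a lo_graph \<Rightarrow> real mat" where
  "skew_adj_mat G = mat (card (vertices G)) (card (vertices G))
     (\<lambda>(i, j).
        if \<exists>x\<in>vertices G. \<exists>y\<in>vertices G.
             label G x = i + 1 \<and> label G y = j + 1 \<and> adjacent G x y
        then (if i < j then 1 else - 1)
        else 0)"

definition skew_char_poly :: "'a lo_graph \<Rightarrow> real poly" where
  "skew_char_poly G = char_poly (skew_adj_mat G)"

definition adj_entry :: "'a lo_graph \<Rightarrow> 'a \<Rightarrow> 'a \<Rightarrow> 'b::comm_ring_1 mat \<Rightarrow> 'b" where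
  "adj_entry G u v X = adj_mat X $$ (label G u - 1, label G v - 1)"

lemma lin_ord_graph_add_edge:
  assumes "lin_ord_graph G" "u \<in> vertices G" "v \<in> vertices G" "label G u < label G v"
  shows "lin_ord_graph (add_edge G u v)"
proof -
  interpret pair_digraph "digraph G" using assms(1) by (simp add: lin_ord_graph_def)
  have "pair_digraph (digraph (add_edge G u v))"
    using assms pair_finite_verts pair_finite_arcs wellformed' pair_no_loops
    by unfold_locales (auto simp: add_edge_def)
  then show ?thesis using assms by (auto simp: lin_ord_graph_def add_edge_def)
qed

lemma label_del_vertex_less:
  assumes "lin_ord_graph G" "x \<in> vertices G - {u}" "y \<in> vertices G - {u}"
    and "label G x < label G y"
  shows "label (del_vertex G u) x < label (del_vertex G u) y"
proof -
  interpret pair_digraph "digraph G" using assms(1) by (simp add: lin_ord_graph_def)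
  let ?S = "\<lambda>z. {w' \<in> vertices G - {u}. label G w' \<le> label G z}"
  have "?S x \<subseteq> ?S y" using assms(4) by auto
  moreover have "y \<in> ?S y" "y \<notin> ?S x" using assms(3,4) by auto
  ultimately have "?S x \<subset> ?S y" by blast
  moreover have "finite (?S y)" using pair_finite_verts by simp
  ultimately have "card (?S x) < card (?S y)" by (intro psubset_card_mono)
  then show ?thesis
    by (simp add: del_vertex_def)
qed

lemma lin_ord_graph_del_vertex:
  assumes "lin_ord_graph G"
  shows "lin_ord_graph (del_vertex G u)"
proof -
  interpret pair_digraph "digraph G" using assms(1) by (simp add: lin_ord_graph_def)
  let ?H = "del_vertex G u"
  have V: "vertices ?H = vertices G - {u}" by (simp add: del_vertex_def)
  have fin: "finite (vertices ?H)" using V pair_finite_verts by simp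
  have dg: "pair_digraph (digraph ?H)"
    using fin pair_finite_arcs wellformed' pair_no_loops
    by unfold_locales (auto simp: del_vertex_def intro: finite_subset[OF _ pair_finite_arcs])
  have inj: "inj_on (label G) (vertices G)"
    using assms by (auto simp: lin_ord_graph_def bij_betw_def)
  have inj': "inj_on (label ?H) (vertices ?H)"
  proof (rule inj_onI)
    fix x y assume xy: "x \<in> vertices ?H" "y \<in> vertices ?H" "label ?H x = label ?H y"
    then have "\<not> label G x < label G y" "\<not> label G y < label G x"
      using label_del_vertex_less[OF assms, of x u y] label_del_vertex_less[OF assms, of y u x] V by auto
    then show "x = y" using inj xy V by (auto simp: inj_on_def)
  qed
  have "label ?H ` vertices ?H \<subseteq> {1..card (vertices ?H)}"
  proof
    fix k assume "k \<in> label ?H ` vertices ?H"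
    then obtain w where w: "w \<in> vertices ?H" "k = label ?H w" by auto
    have k: "k = card {w' \<in> vertices ?H. label G w' \<le> label G w}"
      using w(2) by (simp add: del_vertex_def)
    have "k \<noteq> 0" using w(1) fin k by (auto simp: card_eq_0_iff)
    moreover have "k \<le> card (vertices ?H)" unfolding k by (rule card_mono[OF fin]) auto
    ultimately show "k \<in> {1..card (vertices ?H)}" by simp
  qed
  then have "label ?H ` vertices ?H = {1..card (vertices ?H)}"
    by (intro card_subset_eq) (auto simp: card_image[OF inj'])
  moreover have "label ?H x < label ?H y" if "(x, y) \<in> edges ?H" for x y
  proof -
    have "(x, y) \<in> edges G" "x \<noteq> u" "y \<noteq> u" using that by (auto simp: del_vertex_def)
    then show ?thesis
      using assms wellformed' by (intro label_del_vertex_less) (auto simp: lin_ord_graph_def)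
  qed
  ultimately show ?thesis using dg inj' by (auto simp: lin_ord_graph_def bij_betw_def)
qed

end

theory Submission
  imports Defs
begin

text \<open>
  Put \<open>M = xI - A\<close>, where \<open>A\<close> is the skew-adjacency matrix of \<open>G\<close>, and let \<open>p < q\<close> be the
  indices of \<open>u\<close> and \<open>v\<close>. Since \<open>u\<close> and \<open>v\<close> are not adjacent, the entries of \<open>M\<close> at \<open>(p, q)\<close>
  and \<open>(q, p)\<close> are zero, and the new edge turns them into \<open>-1\<close> and \<open>1\<close> and changes nothing
  else (\<open>char_poly_matrix_add_edge\<close>).

  The determinant is an affine function of each single entry, with the cofactor as its slope
  (\<open>det_add_entry\<close>). Changing the two entries one after the other therefore contributes the two
  cofactors, which are the terms \<open>\<theta>\<^sub>u\<^sub>v\<close> and \<open>\<theta>\<^sub>v\<^sub>u\<close> of the adjugate, and one mixed term: the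
  principal minor of \<open>M\<close> without the rows and columns \<open>p\<close> and \<open>q\<close>, multiplied by minus the
  product of the two changes, which is \<open>+1\<close> (\<open>det_add_opposite_entries\<close>). The transposition
  of \<open>p\<close> and \<open>q\<close> is odd, whence the minus sign.

  Finally, renumbering the remaining vertices by rank is the renumbering of rows and columns that
  striking out a row and a column causes, so this minor is the characteristic polynomial of the
  graph without \<open>u\<close> and \<open>v\<close> (\<open>skew_adj_mat_del_vertex\<close>).
\<close>

section \<open>Determinants under a change of entries\<close>

definition add_entry :: "'a::comm_ring_1 mat \<Rightarrow> nat \<Rightarrow> nat \<Rightarrow> 'a \<Rightarrow> 'a mat" where
  "add_entry A i j a =
     mat (dim_row A) (dim_col A) (\<lambda>(k, l). A $$ (k, l) + (if k = i \<and> l = j then a else 0))"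

lemma add_entry_carrier [simp]: "A \<in> carrier_mat m n \<Longrightarrow> add_entry A i j a \<in> carrier_mat m n"
  by (simp add: add_entry_def)

lemma dim_add_entry [simp]:
  "dim_row (add_entry A i j a) = dim_row A" "dim_col (add_entry A i j a) = dim_col A"
  by (simp_all add: add_entry_def)

lemma index_add_entry [simp]:
  "k < dim_row A \<Longrightarrow> l < dim_col A \<Longrightarrow>
     add_entry A i j a $$ (k, l) = A $$ (k, l) + (if k = i \<and> l = j then a else 0)"
  by (simp add: add_entry_def)

lemma index_mat_delete:
  "k < dim_row A - 1 \<Longrightarrow> l < dim_col A - 1 \<Longrightarrow>
     mat_delete A r c $$ (k, l) = A $$ (insert_index r k, insert_index c l)"
  by (simp add: mat_delete_def insert_index_def)

lemma mat_delete_add_entry_same_row: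
  "mat_delete (add_entry A i j a) i k = mat_delete A i k"
  by (rule eq_matI) (auto simp: mat_delete_def add_entry_def)

lemma mat_delete_add_entry_other:
  assumes "i \<noteq> r" "j \<noteq> c"
  shows "mat_delete (add_entry A i j a) r c
         = add_entry (mat_delete A r c) (delete_index r i) (delete_index c j) a"
proof -
  have index: "insert_index r k = i \<longleftrightarrow> k = delete_index r i"
    "insert_index c k = j \<longleftrightarrow> k = delete_index c j" for k
    using insert_delete_index[OF assms(1)] insert_delete_index[OF assms(2)]
      delete_insert_index by metis+
  show ?thesis
  proof (rule eq_matI)
    fix k l
    assume "k < dim_row (add_entry (mat_delete A r c) (delete_index r i) (delete_index c j) a)"
      and "l < dim_col (add_entry (mat_delete A r c) (delete_index r i) (delete_index c j) a)"
    then have kl: "k < dim_row A - 1" "l < dim_col A - 1" by simp_all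
    then have "insert_index r k < dim_row A" "insert_index c l < dim_col A"
      by (auto simp: insert_index_def)
    then show "mat_delete (add_entry A i j a) r c $$ (k, l)
          = add_entry (mat_delete A r c) (delete_index r i) (delete_index c j) a $$ (k, l)"
      using kl by (simp add: index_mat_delete index)
  qed simp_all
qed

text \<open>
  In the Laplace expansion along row \<open>i\<close> the cofactors do not see row \<open>i\<close>, so the new summand \<open>a\<close>
  meets only the cofactor at \<open>(i, j)\<close>.
\<close>

lemma det_add_entry:
  assumes A: "A \<in> carrier_mat n n" and ij: "i < n" "j < n"
  shows "det (add_entry A i j a) = det A + a * cofactor A i j"
proof -
  have "det (add_entry A i j a)
        = (\<Sum>k<n. add_entry A i j a $$ (i, k) * cofactor (add_entry A i j a) i k)"
    using A ij by (intro laplace_expansion_row) auto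
  also have "\<dots> = (\<Sum>k<n. A $$ (i, k) * cofactor A i k + (if k = j then a * cofactor A i j else 0))"
    using A ij
    by (intro sum.cong)
       (auto simp: cofactor_def mat_delete_add_entry_same_row algebra_simps)
  also have "\<dots> = (\<Sum>k<n. A $$ (i, k) * cofactor A i k) + a * cofactor A i j"
    using ij by (simp add: sum.distrib)
  also have "(\<Sum>k<n. A $$ (i, k) * cofactor A i k) = det A"
    using A ij by (simp add: laplace_expansion_row)
  finally show ?thesis .
qed

text \<open>
  This is the single-entry formula used three times: at \<open>(p, q)\<close>, at \<open>(q, p)\<close>, and inside the
  cofactor at \<open>(p, q)\<close>, which still contains the entry at \<open>(q, p)\<close>. The last use produces the
  mixed term. The second deletion has index \<open>q - 1\<close> because the first one removes
  the smaller index \<open>p\<close>.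
\<close>

lemma det_add_opposite_entries:
  assumes A: "A \<in> carrier_mat n n" and pq: "p < q" "q < n"
  shows "det (add_entry (add_entry A q p b) p q a)
         = det A + a * cofactor A p q + b * cofactor A q p
           - a * b * det (mat_delete (mat_delete A p p) (q - 1) (q - 1))"
proof -
  let ?B = "add_entry A q p b"
  have "det (add_entry ?B p q a) = det ?B + a * cofactor ?B p q"
    using A pq by (intro det_add_entry[where n = n]) auto
  also have "det ?B = det A + b * cofactor A q p"
    using A pq by (intro det_add_entry[where n = n]) auto
  also have "cofactor ?B p q
             = cofactor A p q - b * det (mat_delete (mat_delete A p p) (q - 1) (q - 1))"
  proof -
    have D: "mat_delete A p q \<in> carrier_mat (n - 1) (n - 1)"
      using A by (simp add: mat_delete_def)
    \<comment> \<open>Striking out row \<open>p\<close> shifts row \<open>q\<close> up by one, whereas striking out column \<open>q\<close>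
        leaves column \<open>p\<close> in place.\<close>
    have "mat_delete ?B p q = add_entry (mat_delete A p q) (q - 1) p b"
      using pq by (subst mat_delete_add_entry_other) (auto simp: delete_index_def)
    then have "det (mat_delete ?B p q)
               = det (mat_delete A p q) + b * cofactor (mat_delete A p q) (q - 1) p"
      using pq by (simp only:) (rule det_add_entry[OF D], auto)
    moreover have "mat_delete (mat_delete A p q) (q - 1) p
                   = mat_delete (mat_delete A p p) (q - 1) (q - 1)"
      using A pq by (intro eq_matI) (auto simp: mat_delete_def)
    ultimately have det_minor: "det (mat_delete ?B p q) = det (mat_delete A p q)
        + b * ((-1) ^ (q - 1 + p) * det (mat_delete (mat_delete A p p) (q - 1) (q - 1)))"
      by (simp add: cofactor_def)
    have "(-1) ^ (p + q) * (-1) ^ (q - 1 + p) = (-1 :: 'a)"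
    proof -
      have "p + q + (q - 1 + p) = Suc (2 * (p + q - 1))" using pq by simp
      then have "(-1) ^ (p + q) * (-1) ^ (q - 1 + p) = (-1 :: 'a) ^ Suc (2 * (p + q - 1))"
        by (metis power_add)
      also have "\<dots> = -1"
        by (simp only: power_Suc power_mult power2_minus power_one mult_1_right)
      finally show ?thesis .
    qed
    moreover have "x * (b * (y * d)) = x * y * (b * d)" for x y d :: 'a
      by (simp only: ac_simps)
    ultimately have "(-1) ^ (p + q) * (b * ((-1) ^ (q - 1 + p) * d)) = - (b * d)" for d :: 'a
      by (simp only: mult_minus1)
    then show ?thesis unfolding cofactor_def det_minor by (simp add: distrib_left)
  qed
  finally show ?thesis by (simp add: algebra_simps)
qed

section \<open>Deleting a vertex\<close>

lemma insert_index_less_iff: "insert_index p i < insert_index p j \<longleftrightarrow> i < j"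
  by (simp add: insert_index_def)

lemma char_poly_matrix_mat_delete:
  assumes "A \<in> carrier_mat n n"
  shows "char_poly_matrix (mat_delete A p p) = mat_delete (char_poly_matrix A) p p"
  using assms by (intro eq_matI) (auto simp: char_poly_matrix_def mat_delete_def)

lemma label_range:
  assumes "lin_ord_graph G" "x \<in> vertices G"
  shows "label G x \<in> {1..card (vertices G)}"
  using assms by (auto simp: lin_ord_graph_def bij_betw_def)

text \<open>
  The rank of \<open>x\<close> among the remaining vertices is its old label, lowered by one if \<open>w\<close> came before
  it. The first part says this in terms of \<open>insert_index\<close>, the map from the row indices of a matrix
  with one row struck out to those of the original. The second part is needed because
  truncated subtraction would not tell a new label 0 from 1.
\<close>

lemma label_del_vertex:
  assumes G: "lin_ord_graph G" and w: "w \<in> vertices G" and x: "x \<in> vertices G - {w}"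
  shows "label G x = insert_index (label G w - 1) (label (del_vertex G w) x - 1) + 1"
    and "label (del_vertex G w) x \<ge> 1"
proof -
  have bij: "bij_betw (label G) (vertices G) {1..card (vertices G)}"
    using G by (simp add: lin_ord_graph_def)
  then have inj: "inj_on (label G) (vertices G)"
    and img: "label G ` vertices G = {1..card (vertices G)}"
    by (auto simp: bij_betw_def)
  have ge: "label G w \<ge> 1" "label G x \<ge> 1" and le: "label G x \<le> card (vertices G)"
    using img w x by auto
  have neq: "label G x \<noteq> label G w" using inj w x by (auto simp: inj_on_def)
  let ?S = "{w' \<in> vertices G - {w}. label G w' \<le> label G x}"
  have "label G ` ?S = {1..label G x} - {label G w}"
  proof (intro equalityI subsetI)
    fix k assume k: "k \<in> {1..label G x} - {label G w}"
    then have "k \<in> label G ` vertices G" using img le by auto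
    then show "k \<in> label G ` ?S" using k by auto
  next
    fix k assume "k \<in> label G ` ?S"
    then show "k \<in> {1..label G x} - {label G w}"
      using img inj w by (auto simp: inj_on_def)
  qed
  moreover have "inj_on (label G) ?S" using inj by (auto simp: inj_on_def)
  ultimately have "label (del_vertex G w) x = card ({1..label G x} - {label G w})"
    using card_image[of "label G" ?S] by (simp add: del_vertex_def)
  also have "\<dots> = (if label G w < label G x then label G x - 1 else label G x)"
    using ge neq by auto
  finally have l: "label (del_vertex G w) x = (if label G w < label G x then label G x - 1 else label G x)" .
  show "label (del_vertex G w) x \<ge> 1" using l ge by auto
  show "label G x = insert_index (label G w - 1) (label (del_vertex G w) x - 1) + 1"
    using l ge neq by (auto simp: insert_index_def)
qed

lemma skew_adj_mat_carrier:
  "skew_adj_mat G \<in> carrier_mat (card (vertices G)) (card (vertices G))"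
  by (simp add: skew_adj_mat_def)

text \<open>
  The index map \<open>insert_index\<close> is strictly increasing, so it keeps not only adjacency but also the
  orientation that determines the sign of an entry.
\<close>

lemma skew_adj_mat_del_vertex:
  assumes G: "lin_ord_graph G" and w: "w \<in> vertices G"
  shows "skew_adj_mat (del_vertex G w)
         = mat_delete (skew_adj_mat G) (label G w - 1) (label G w - 1)"
proof -
  let ?H = "del_vertex G w" and ?p = "label G w - 1"
  interpret pair_digraph "digraph G" using G by (simp add: lin_ord_graph_def)
  have V: "vertices ?H = vertices G - {w}" by (simp add: del_vertex_def)
  have adj: "adjacent ?H x y \<longleftrightarrow> adjacent G x y" if "x \<noteq> w" "y \<noteq> w" for x y
    using that by (auto simp: adjacent_def del_vertex_def)
  have card: "card (vertices ?H) = card (vertices G) - 1"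
    using w pair_finite_verts V by simp
  have lw: "label G w \<in> {1..card (vertices G)}"
    using label_range[OF G w] .
  have index: "label ?H x = i + 1 \<longleftrightarrow> label G x = insert_index ?p i + 1"
    if "x \<in> vertices G - {w}" for x i
  proof -
    have "insert_index ?p (label ?H x - 1) = insert_index ?p i \<longleftrightarrow> label ?H x - 1 = i"
      by (auto simp: insert_index_def)
    then show ?thesis using label_del_vertex[OF G w that] by auto
  qed
  have w_index: "label G w \<noteq> insert_index ?p i + 1" for i
    using lw by (auto simp: insert_index_def)
  have ex: "(\<exists>x\<in>vertices ?H. \<exists>y\<in>vertices ?H. label ?H x = i + 1 \<and> label ?H y = j + 1 \<and> adjacent ?H x y)
     \<longleftrightarrow> (\<exists>x\<in>vertices G. \<exists>y\<in>vertices G. label G x = insert_index ?p i + 1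
            \<and> label G y = insert_index ?p j + 1 \<and> adjacent G x y)" for i j
  proof -
    have "(x \<in> vertices G - {w} \<and> label ?H x = k + 1)
          \<longleftrightarrow> (x \<in> vertices G \<and> label G x = insert_index ?p k + 1)" for x k
      using index[of x k] w_index[of k] by blast
    then show ?thesis unfolding V using adj by blast
  qed
  show ?thesis
  proof (rule eq_matI)
    fix i j
    assume "i < dim_row (mat_delete (skew_adj_mat G) ?p ?p)"
      and "j < dim_col (mat_delete (skew_adj_mat G) ?p ?p)"
    then have ij: "i < card (vertices G) - 1" "j < card (vertices G) - 1"
      by (auto simp: skew_adj_mat_def)
    then have ins: "insert_index ?p i < card (vertices G)" "insert_index ?p j < card (vertices G)"
      by (auto simp: insert_index_def)
    have "mat_delete (skew_adj_mat G) ?p ?p $$ (i, j)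
          = skew_adj_mat G $$ (insert_index ?p i, insert_index ?p j)"
      using ij by (intro index_mat_delete) (simp_all add: skew_adj_mat_def)
    also have "\<dots> = skew_adj_mat ?H $$ (i, j)"
      using ij ins card ex[of i j] unfolding skew_adj_mat_def
      by (simp only: index_mat prod.case insert_index_less_iff)
    finally show "skew_adj_mat ?H $$ (i, j) = mat_delete (skew_adj_mat G) ?p ?p $$ (i, j)" ..
  qed (simp_all add: skew_adj_mat_def card)
qed

text \<open>
  The row of \<open>v\<close> is struck out at \<open>label G v - 2\<close>: one is lost because indices start at 0, and one
  because \<open>u\<close> comes before \<open>v\<close> and is already gone.
\<close>

lemma skew_char_poly_del_two_vertices:
  assumes G: "lin_ord_graph G" and uv: "u \<in> vertices G" "v \<in> vertices G"
    and less: "label G u < label G v"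
  shows "skew_char_poly (del_vertex (del_vertex G u) v)
         = det (mat_delete (mat_delete (char_poly_matrix (skew_adj_mat G))
             (label G u - 1) (label G u - 1)) (label G v - 2) (label G v - 2))"
proof -
  let ?H = "del_vertex G u"
  have vH: "v \<in> vertices ?H" and v: "v \<in> vertices G - {u}"
    using uv less by (auto simp: del_vertex_def)
  have "label G u \<ge> 1"
    using label_range[OF G uv(1)] by simp
  then have lv: "label ?H v - 1 = label G v - 2"
    using label_del_vertex[OF G uv(1) v] less by (auto simp: insert_index_def split: if_splits)
  show ?thesis
    unfolding skew_char_poly_def char_poly_def
      skew_adj_mat_del_vertex[OF lin_ord_graph_del_vertex[OF G] vH] lv
      skew_adj_mat_del_vertex[OF G uv(1)]
    using char_poly_matrix_mat_delete[OF skew_adj_mat_carrier[of G]]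
      char_poly_matrix_mat_delete[OF mat_delete_carrier[OF skew_adj_mat_carrier[of G]]]
    by simp
qed

section \<open>Adding an edge\<close>

lemma char_poly_matrix_add_edge:
  assumes G: "lin_ord_graph G" and uv: "u \<in> vertices G" "v \<in> vertices G"
    and less: "label G u < label G v" and nonadj: "\<not> adjacent G u v"
  shows "char_poly_matrix (skew_adj_mat (add_edge G u v))
         = add_entry (add_entry (char_poly_matrix (skew_adj_mat G))
             (label G v - 1) (label G u - 1) 1) (label G u - 1) (label G v - 1) (-1)"
    (is "?L = ?R")
proof -
  let ?n = "card (vertices G)"
  have inj: "inj_on (label G) (vertices G)"
    using G by (simp add: lin_ord_graph_def bij_betw_def)
  define p where "p = label G u - 1"
  define q where "q = label G v - 1"
  have lab: "label G u = p + 1" "label G v = q + 1"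
    using label_range[OF G uv(1)] label_range[OF G uv(2)] by (auto simp: p_def q_def)
  have u_eq: "x = u" if "x \<in> vertices G" "label G x = p + 1" for x
    using inj_onD[OF inj _ that(1) uv(1)] that(2) lab(1) by simp
  have v_eq: "x = v" if "x \<in> vertices G" "label G x = q + 1" for x
    using inj_onD[OF inj _ that(1) uv(2)] that(2) lab(2) by simp
  have same: "vertices (add_edge G u v) = vertices G" "label (add_edge G u v) = label G"
    by (simp_all add: add_edge_def)
  have adj: "adjacent (add_edge G u v) x y
             \<longleftrightarrow> adjacent G x y \<or> x = u \<and> y = v \<or> x = v \<and> y = u" for x y
    by (auto simp: adjacent_def add_edge_def)
  let ?E = "\<lambda>i j. \<exists>x\<in>vertices G. \<exists>y\<in>vertices G. label G x = i + 1 \<and> label G y = j + 1 \<and> adjacent G x y"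
  let ?E' = "\<lambda>i j. \<exists>x\<in>vertices G. \<exists>y\<in>vertices G. label G x = i + 1 \<and> label G y = j + 1
    \<and> adjacent (add_edge G u v) x y"
  have label_iff: "label G u = k + 1 \<longleftrightarrow> k = p" "label G v = k + 1 \<longleftrightarrow> k = q" for k
    using lab by auto
  have E': "?E' i j \<longleftrightarrow> ?E i j \<or> i = p \<and> j = q \<or> i = q \<and> j = p" for i j
    unfolding adj using uv label_iff by blast
  have E: "\<not> ?E p q" "\<not> ?E q p"
    using u_eq v_eq nonadj by (auto simp: adjacent_def)
  have pq: "p < q" using less lab by simp
  have R: "?R = add_entry (add_entry (char_poly_matrix (skew_adj_mat G)) q p 1) p q (-1)"
    by (simp add: p_def q_def)
  have dims: "dim_row ?L = ?n" "dim_col ?L = ?n" "dim_row ?R = ?n" "dim_col ?R = ?n"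
    by (simp_all add: add_entry_def char_poly_matrix_def skew_adj_mat_def same)
  show ?thesis
  proof (rule eq_matI)
    fix i j assume "i < dim_row ?R" "j < dim_col ?R"
    then have ij: "i < ?n" "j < ?n" by (simp_all only: dims)
    have A: "skew_adj_mat G $$ (i, j) = (if ?E i j then if i < j then 1 else - 1 else 0)"
      using ij by (simp add: skew_adj_mat_def)
    have "skew_adj_mat (add_edge G u v) $$ (i, j) = (if ?E' i j then if i < j then 1 else - 1 else 0)"
      using ij by (simp add: skew_adj_mat_def same)
    then have A': "skew_adj_mat (add_edge G u v) $$ (i, j) = skew_adj_mat G $$ (i, j)
        + (if i = q \<and> j = p then -1 else 0) + (if i = p \<and> j = q then 1 else 0)"
      unfolding A E' using E pq by auto
    show "?L $$ (i, j) = ?R $$ (i, j)"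
      using ij A' pq skew_adj_mat_carrier[of G] skew_adj_mat_carrier[of "add_edge G u v"]
      unfolding R by (auto simp: add_entry_def char_poly_matrix_def same)
  qed (simp_all only: dims)
qed

text \<open>The adjugate is the transposed cofactor matrix, hence the exchange of \<open>u\<close> and \<open>v\<close>.\<close>

lemma adj_entry_eq_cofactor:
  assumes "X \<in> carrier_mat n n" "label G u - 1 < n" "label G v - 1 < n"
  shows "adj_entry G u v X = cofactor X (label G v - 1) (label G u - 1)"
  using assms by (simp add: adj_entry_def adj_mat_def)

theorem theorem6:
  fixes G :: "'a lo_graph" and u v :: 'a
  assumes "lin_ord_graph G"
    and "u \<in> vertices G" and "v \<in> vertices G"
    and "label G v = label G u + 1"
    and "\<not> adjacent G u v"
  shows "skew_char_poly (add_edge G u v) =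
           skew_char_poly (del_vertex (del_vertex G u) v) + skew_char_poly G
           + adj_entry G u v (char_poly_matrix (skew_adj_mat G))
           - adj_entry G v u (char_poly_matrix (skew_adj_mat G))"
proof -
  let ?n = "card (vertices G)" and ?p = "label G u - 1" and ?q = "label G v - 1"
  let ?M = "char_poly_matrix (skew_adj_mat G)"
  have M: "?M \<in> carrier_mat ?n ?n"
    using skew_adj_mat_carrier[of G] by (simp add: char_poly_matrix_def)
  have less: "label G u < label G v" using assms(4) by simp
  have "label G u \<in> {1..?n}" "label G v \<in> {1..?n}"
    using label_range[OF assms(1)] assms(2,3) by blast+
  then have pq: "?p < ?q" "?p < ?n" "?q < ?n" using less by auto
  have "skew_char_poly (add_edge G u v) = det (add_entry (add_entry ?M ?q ?p 1) ?p ?q (-1))"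
    using char_poly_matrix_add_edge[OF assms(1-3) less assms(5)]
    by (simp add: skew_char_poly_def char_poly_def)
  also have "\<dots> = det ?M - cofactor ?M ?p ?q + cofactor ?M ?q ?p
                  + det (mat_delete (mat_delete ?M ?p ?p) (?q - 1) (?q - 1))"
    using det_add_opposite_entries[OF M pq(1,3), of 1 "-1"] by simp
  also have "det (mat_delete (mat_delete ?M ?p ?p) (?q - 1) (?q - 1))
             = skew_char_poly (del_vertex (del_vertex G u) v)"
    using skew_char_poly_del_two_vertices[OF assms(1-3) less] by (simp add: numeral_2_eq_2)
  also have "det ?M = skew_char_poly G"
    by (simp add: skew_char_poly_def char_poly_def)
  finally show ?thesis
    by (simp add: adj_entry_eq_cofactor[OF M pq(2,3)] adj_entry_eq_cofactor[OF M pq(3,2)])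
qed

end
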